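(* Let $G=(V,E)$ be a finite graph with signed incidence matrix $P$, let $k\ge1$, $\lambda>0$ and $p\ge 1$. The unbalanced lifted distance $A_{\lambda,p}:M(V)^{k*}\times M(V)^{k*}\to\mathbb{R}$, $$A_{\lambda,p}(X,Y)=\min_{S\in\mathrm{DS}_k}\ \sum_{i,j=1}^k S_{ij}\,C_{\lambda,p}(x_i,y_j),\qquad X=(x_1,\dots,x_k),\ Y=(y_1,\dots,y_k),$$ is a metric on $M(V)^{k*}$.
   Context: Graphs are simple, and each edge is given a fixed orientation. The signed incidence matrix $P\in\mathbb{R}^{|E|\times|V|}$ has $P_{ev}=-1$ if $e=(v,w)$ for some $w$, $P_{ev}=1$ if $e=(w,v)$ for some $w$, and $P_{ev}=0$ otherwise. $M(V)=\{x\in\mathbb{R}^{|V|} : x(v)\ge 0\ \forall v\in V\}$, and $M(V)^{k*}$ is the set of $k$-tuples of elements of $M(V)$ up to reordering. For $x,y\in M(V)$, $C_{\lambda,p}(x,y)=\min\{\|J\|_1+\lambda\|z\|_p : J\in\mathbb{R}^{|E|},\ z\in\mathbb{R}^{|V|},\ P^\top J=y-x+z\}$. $\mathrm{DS}_k$ is the set of doubly stochastic $k\times k$ matrices (nonnegative, all rows and columns summing to 1). *)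

theory Defs
  imports "HOL-Analysis.Analysis" "HOL-Combinatorics.Permutations"
begin

(* A finite simple graph with a fixed orientation: each edge is recorded once, as the ordered pair
   (tail, head).  Asymmetry of E excludes both loops and a second, opposite copy of an edge. *)
locale oriented_graph =
  fixes V :: "'v set" and E :: "('v \<times> 'v) set"
  assumes finite_verts: "finite V"
    and edges_subset: "E \<subseteq> V \<times> V"
    and edges_asym: "asym E"

definition incidence :: "'v \<times> 'v \<Rightarrow> 'v \<Rightarrow> real" where
  "incidence e v =
     (if \<exists>w. e = (v, w) then - 1 else if \<exists>w. e = (w, v) then 1 else 0)"

(* Vectors indexed by a set I are extensional functions on I, so that equality of vectors is
   equality of functions. *)
definition vectors :: "'i set \<Rightarrow> ('i \<Rightarrow> real) set" where
  "vectors I = (I \<rightarrow>\<^sub>E UNIV)"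

definition mass_vectors :: "'v set \<Rightarrow> ('v \<Rightarrow> real) set" where
  "mass_vectors V = {x \<in> vectors V. \<forall>v\<in>V. 0 \<le> x v}"

definition lp_norm :: "'i set \<Rightarrow> real \<Rightarrow> ('i \<Rightarrow> real) \<Rightarrow> real" where
  "lp_norm I p z = (\<Sum>i\<in>I. \<bar>z i\<bar> powr p) powr (1 / p)"

(* For a set of reals, Least is the minimum in the strict sense (not the infimum): it has
   a specified value only if the minimum is attained. *)
definition unbalanced_cost ::
    "'v set \<Rightarrow> ('v \<times> 'v) set \<Rightarrow> real \<Rightarrow> real \<Rightarrow> ('v \<Rightarrow> real) \<Rightarrow> ('v \<Rightarrow> real) \<Rightarrow> real" where
  "unbalanced_cost V E lam p x y =
     (LEAST c. c \<in> {(\<Sum>e\<in>E. \<bar>J e\<bar>) + lam * lp_norm V p z | J z.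
        J \<in> vectors E \<and> z \<in> vectors V \<and>
        (\<forall>v\<in>V. (\<Sum>e\<in>E. incidence e v * J e) = y v - x v + z v)})"

(* Only the entries S i j with i, j < k belong to the matrix. *)
definition doubly_stochastic :: "nat \<Rightarrow> (nat \<Rightarrow> nat \<Rightarrow> real) set" where
  "doubly_stochastic k = {S. (\<forall>i<k. \<forall>j<k. 0 \<le> S i j) \<and>
     (\<forall>i<k. (\<Sum>j<k. S i j) = 1) \<and> (\<forall>j<k. (\<Sum>i<k. S i j) = 1)}"

definition lifted_dist_list ::
    "'v set \<Rightarrow> ('v \<times> 'v) set \<Rightarrow> real \<Rightarrow> real \<Rightarrow> nat \<Rightarrow>
      ('v \<Rightarrow> real) list \<Rightarrow> ('v \<Rightarrow> real) list \<Rightarrow> real" where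
  "lifted_dist_list V E lam p k xs ys =
     (LEAST c. c \<in> {\<Sum>i<k. \<Sum>j<k. S i j * unbalanced_cost V E lam p (xs ! i) (ys ! j) | S.
        S \<in> doubly_stochastic k})"

(* k-tuples up to reordering are multisets of size k. *)
definition unordered_tuples :: "nat \<Rightarrow> 'a set \<Rightarrow> 'a multiset set" where
  "unordered_tuples k A = {X. size X = k \<and> set_mset X \<subseteq> A}"

(* Evaluated on an arbitrary ordering of each multiset; lifted_dist_mset below shows that the
   choice is irrelevant. *)
definition lifted_dist ::
    "'v set \<Rightarrow> ('v \<times> 'v) set \<Rightarrow> real \<Rightarrow> real \<Rightarrow> nat \<Rightarrow>
      ('v \<Rightarrow> real) multiset \<Rightarrow> ('v \<Rightarrow> real) multiset \<Rightarrow> real" where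
  "lifted_dist V E lam p k X Y =
     lifted_dist_list V E lam p k (SOME xs. mset xs = X) (SOME ys. mset ys = Y)"

lemma doubly_stochastic_permute:
  assumes "S \<in> doubly_stochastic k" "\<pi> permutes {..<k}" "\<sigma> permutes {..<k}"
  shows "(\<lambda>i j. S (\<pi> i) (\<sigma> j)) \<in> doubly_stochastic k"
proof -
  have "\<pi> i < k" if "i < k" for i using permutes_in_image[OF assms(2), of i] that by simp
  moreover have "\<sigma> i < k" if "i < k" for i using permutes_in_image[OF assms(3), of i] that by simp
  moreover have "(\<Sum>j<k. S i (\<sigma> j)) = (\<Sum>j<k. S i j)" for i
    using sum.permute[OF assms(3), of "S i"] by (simp add: o_def)
  moreover have "(\<Sum>i<k. S (\<pi> i) j) = (\<Sum>i<k. S i j)" for j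
    using sum.permute[OF assms(2), of "\<lambda>i. S i j"] by (simp add: o_def)
  ultimately show ?thesis
    using assms(1) by (simp add: doubly_stochastic_def)
qed

lemma lifted_sum_permute:
  fixes c :: "'a \<Rightarrow> 'b \<Rightarrow> real"
  assumes "mset xs = mset xs'" "mset ys = mset ys'" "length xs = k" "length ys = k"
  shows "{\<Sum>i<k. \<Sum>j<k. S i j * c (xs ! i) (ys ! j) | S. S \<in> doubly_stochastic k}
    \<subseteq> {\<Sum>i<k. \<Sum>j<k. S i j * c (xs' ! i) (ys' ! j) | S. S \<in> doubly_stochastic k}"
proof clarify
  fix S assume S: "S \<in> doubly_stochastic k"
  obtain \<pi> where \<pi>: "\<pi> permutes {..<k}" "permute_list \<pi> xs = xs'"
    using mset_eq_permutation[OF assms(1)[symmetric]] assms(3) by metis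
  obtain \<sigma> where \<sigma>: "\<sigma> permutes {..<k}" "permute_list \<sigma> ys = ys'"
    using mset_eq_permutation[OF assms(2)[symmetric]] assms(4) by metis
  have nth: "i < k \<Longrightarrow> xs' ! i = xs ! \<pi> i" "i < k \<Longrightarrow> ys' ! i = ys ! \<sigma> i" for i
    using \<pi> \<sigma> assms(3,4) by (auto simp: permute_list_nth)
  have "(\<Sum>i<k. \<Sum>j<k. S i j * c (xs ! i) (ys ! j)) =
      (\<Sum>i<k. \<Sum>j<k. S (\<pi> i) j * c (xs ! \<pi> i) (ys ! j))"
    using sum.permute[OF \<pi>(1), of "\<lambda>i. \<Sum>j<k. S i j * c (xs ! i) (ys ! j)"] by (simp add: o_def)
  also have "\<dots> = (\<Sum>i<k. \<Sum>j<k. S (\<pi> i) (\<sigma> j) * c (xs ! \<pi> i) (ys ! \<sigma> j))"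
    using sum.permute[OF \<sigma>(1), of "\<lambda>j. S (\<pi> i) j * c (xs ! \<pi> i) (ys ! j)" for i]
    by (simp add: o_def)
  also have "\<dots> = (\<Sum>i<k. \<Sum>j<k. S (\<pi> i) (\<sigma> j) * c (xs' ! i) (ys' ! j))"
    by (intro sum.cong) (auto simp: nth)
  finally show "\<exists>S'. (\<Sum>i<k. \<Sum>j<k. S i j * c (xs ! i) (ys ! j)) =
      (\<Sum>i<k. \<Sum>j<k. S' i j * c (xs' ! i) (ys' ! j)) \<and> S' \<in> doubly_stochastic k"
    using doubly_stochastic_permute[OF S \<pi>(1) \<sigma>(1)]
    by (intro exI[of _ "\<lambda>i j. S (\<pi> i) (\<sigma> j)"]) auto
qed

lemma lifted_dist_mset:
  assumes "length xs = k" "length ys = k"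
  shows "lifted_dist V E lam p k (mset xs) (mset ys) = lifted_dist_list V E lam p k xs ys"
proof -
  define xs' where "xs' = (SOME zs. mset zs = mset xs)"
  define ys' where "ys' = (SOME zs. mset zs = mset ys)"
  have ms: "mset xs' = mset xs" "mset ys' = mset ys"
    unfolding xs'_def ys'_def by (rule someI[of _ xs], rule refl, rule someI[of _ ys], rule refl)
  then have len: "length xs' = k" "length ys' = k"
    using assms mset_eq_length by metis+
  note sub = lifted_sum_permute[where c = "unbalanced_cost V E lam p"]
  show ?thesis
    unfolding lifted_dist_def xs'_def[symmetric] ys'_def[symmetric] lifted_dist_list_def
    using equalityI[OF sub[OF ms len] sub[OF ms(1)[symmetric] ms(2)[symmetric] assms]]
    by simp
qed

end

theory Submission
  imports Defs
begin

(* Minima are attained by compactness of boxes, after bounding the flow J by the cost of J = 0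
   (z is determined by J).  The triangle inequality for C adds flows and uses Minkowski's
   inequality; the one for A multiplies the optimal doubly stochastic matrices.  If A(X,Y) = 0,
   an optimal S is supported on pairs with x_i = y_j, and summing the corresponding entries by
   rows and by columns shows that every vector has the same multiplicity in X and in Y. *)

section \<open>Minkowski's inequality\<close>

text \<open>For positive \<open>u\<close> and \<open>w\<close> this is convexity of the power
  function. If one of them is 0, it reduces to \<open>r powr p \<le> r\<close> for
  \<open>0 < r < 1\<close>, which holds because \<open>1 \<le> p\<close>.\<close>

lemma powr_convex_nonneg:
  fixes p s t u w :: real
  assumes "1 \<le> p" "0 < s" "0 < t" "s + t = 1" "0 \<le> u" "0 \<le> w"
  shows "(s * u + t * w) powr p \<le> s * u powr p + t * w powr p"
proof -
  have scale: "(r * a) powr p \<le> r * a powr p" if "0 < r" "r < 1" "0 \<le> a" for r a :: real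
  proof -
    have "r powr p \<le> r powr 1"
      using that assms(1) by (intro powr_mono') auto
    then show ?thesis
      using that by (simp add: powr_mult mult_right_mono)
  qed
  consider "u = 0" | "w = 0" | "u > 0" "w > 0"
    using assms by linarith
  then show ?thesis
  proof cases
    case 3
    have "s = 1 - t" using assms by simp
    then show ?thesis
      using convex_onD[OF powr_convex[OF assms(1)], of t u w] assms(2,3) 3 by simp
  qed (use scale assms in auto)
qed

lemma lp_norm_nonneg: "0 \<le> lp_norm I p z"
  by (simp add: lp_norm_def)

lemma lp_norm_cong: "(\<And>i. i \<in> I \<Longrightarrow> x i = y i) \<Longrightarrow> lp_norm I p x = lp_norm I p y"
  by (simp add: lp_norm_def)

lemma lp_norm_minus: "lp_norm I p (\<lambda>i. - z i) = lp_norm I p z"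
  by (simp add: lp_norm_def)

lemma lp_norm_eq_0_iff:
  assumes "finite I"
  shows "lp_norm I p z = 0 \<longleftrightarrow> (\<forall>i\<in>I. z i = 0)"
  using assms by (simp add: lp_norm_def sum_nonneg_eq_0_iff)

lemma lp_norm_powr:
  assumes "0 < p"
  shows "lp_norm I p z powr p = (\<Sum>i\<in>I. \<bar>z i\<bar> powr p)"
  using assms by (simp add: lp_norm_def powr_powr sum_nonneg)

text \<open>Minkowski's inequality, by normalising: \<open>x\<close> and \<open>y\<close> are
  divided by their norms \<open>a\<close> and \<open>b\<close>, and convexity of the power function
  is applied in each coordinate. A vector of norm 0 vanishes on \<open>I\<close> and is treated
  separately.\<close>

lemma lp_norm_triangle:
  assumes "finite I" "1 \<le> p"
  shows "lp_norm I p (\<lambda>i. x i + y i) \<le> lp_norm I p x + lp_norm I p y"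
proof -
  define a b where "a = lp_norm I p x" and "b = lp_norm I p y"
  consider "a = 0" | "b = 0" | "a > 0" "b > 0"
    using lp_norm_nonneg[of I p x] lp_norm_nonneg[of I p y] unfolding a_def b_def by linarith
  then show ?thesis
  proof cases
    case 1
    then have "lp_norm I p (\<lambda>i. x i + y i) = lp_norm I p y"
      using assms by (intro lp_norm_cong) (auto simp: a_def lp_norm_eq_0_iff)
    then show ?thesis
      by (simp add: lp_norm_nonneg)
  next
    case 2
    then have "lp_norm I p (\<lambda>i. x i + y i) = lp_norm I p x"
      using assms by (intro lp_norm_cong) (auto simp: b_def lp_norm_eq_0_iff)
    then show ?thesis
      by (simp add: lp_norm_nonneg)
  next
    case 3
    then have ab: "a + b \<noteq> 0"
      by simp
    have unit: "(\<Sum>i\<in>I. (\<bar>z i\<bar> / c) powr p) = 1" if "c = lp_norm I p z" "0 < c" for c z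
      using that assms by (simp add: powr_divide flip: sum_divide_distrib lp_norm_powr)
    \<comment> \<open>The weights \<open>a / (a + b)\<close> and \<open>b / (a + b)\<close> sum to 1
      and make \<open>\<bar>x i\<bar> + \<bar>y i\<bar>\<close> equal to \<open>a + b\<close> times
      a convex combination of the normalised entries. After summation \<open>unit\<close> collapses
      the bracket to 1.\<close>
    have "(\<Sum>i\<in>I. \<bar>x i + y i\<bar> powr p) \<le>
        (\<Sum>i\<in>I. (a + b) powr p *
          (a / (a + b) * (\<bar>x i\<bar> / a) powr p + b / (a + b) * (\<bar>y i\<bar> / b) powr p))"
    proof (rule sum_mono)
      fix i
      have "\<bar>x i + y i\<bar> powr p \<le> (\<bar>x i\<bar> + \<bar>y i\<bar>) powr p"
        using assms by (intro powr_mono2) auto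
      also have "\<bar>x i\<bar> + \<bar>y i\<bar> =
          (a + b) * (a / (a + b) * (\<bar>x i\<bar> / a) + b / (a + b) * (\<bar>y i\<bar> / b))"
        using 3 ab by (simp add: distrib_left)
      also have "\<dots> powr p = (a + b) powr p *
          (a / (a + b) * (\<bar>x i\<bar> / a) + b / (a + b) * (\<bar>y i\<bar> / b)) powr p"
        by (rule powr_mult)
      also have "\<dots> \<le> (a + b) powr p *
          (a / (a + b) * (\<bar>x i\<bar> / a) powr p + b / (a + b) * (\<bar>y i\<bar> / b) powr p)"
        using 3 assms
        by (intro mult_left_mono powr_convex_nonneg) (auto simp flip: add_divide_distrib)
      finally show "\<bar>x i + y i\<bar> powr p \<le> (a + b) powr p *
          (a / (a + b) * (\<bar>x i\<bar> / a) powr p + b / (a + b) * (\<bar>y i\<bar> / b) powr p)" .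
    qed
    also have "\<dots> = (a + b) powr p * (a / (a + b) * (\<Sum>i\<in>I. (\<bar>x i\<bar> / a) powr p)
        + b / (a + b) * (\<Sum>i\<in>I. (\<bar>y i\<bar> / b) powr p))"
      by (simp add: sum_distrib_left sum.distrib distrib_left)
    also have "\<dots> = (a + b) powr p"
      using 3 unit[OF a_def] unit[OF b_def] by (simp flip: add_divide_distrib)
    finally have "lp_norm I p (\<lambda>i. x i + y i) \<le> ((a + b) powr p) powr (1 / p)"
      unfolding lp_norm_def using assms by (intro powr_mono2) (auto intro: sum_nonneg)
    then show ?thesis
      using 3 assms by (simp add: powr_powr a_def b_def)
  qed
qed

text \<open>Both exponents \<open>p\<close> and \<open>1 / p\<close> are positive, so
  \<open>powr\<close> on nonnegative bases is continuous at base 0 as well.\<close>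

lemma continuous_on_lp_norm:
  assumes "0 < p" "\<And>i. i \<in> I \<Longrightarrow> continuous_on A (\<lambda>a. z a i)"
  shows "continuous_on A (\<lambda>a. lp_norm I p (z a))"
  unfolding lp_norm_def
  by (intro continuous_on_powr' continuous_intros assms) (use assms in \<open>auto intro: sum_nonneg\<close>)

section \<open>The transport cost\<close>

text \<open>Tychonoff's theorem for the product topology on a function type. It supplies the compact
  boxes for flows and for matrices.\<close>

lemma compact_PiE_UNIV:
  fixes K :: "'i \<Rightarrow> 'b::topological_space set"
  assumes "\<And>i. compact (K i)"
  shows "compact (PiE UNIV K)"
  using compactin_PiE[of "\<lambda>i. euclidean" UNIV K] assms
  by (simp add: euclidean_product_topology)

text \<open>The constraint in \<open>unbalanced_cost\<close> without the extensionality conditions,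
  so that pointwise sums and negatives of flows are admissible as they stand.\<close>

definition residual_flow ::
    "'v set \<Rightarrow> ('v \<times> 'v) set \<Rightarrow> ('v \<Rightarrow> real) \<Rightarrow> ('v \<Rightarrow> real) \<Rightarrow> ('v \<times> 'v \<Rightarrow> real) \<Rightarrow>
      ('v \<Rightarrow> real) \<Rightarrow> bool" where
  "residual_flow V E x y J z \<longleftrightarrow>
     (\<forall>v\<in>V. (\<Sum>e\<in>E. incidence e v * J e) = y v - x v + z v)"

definition flow_cost ::
    "'v set \<Rightarrow> ('v \<times> 'v) set \<Rightarrow> real \<Rightarrow> real \<Rightarrow> ('v \<times> 'v \<Rightarrow> real) \<Rightarrow> ('v \<Rightarrow> real) \<Rightarrow> real" where
  "flow_cost V E lam p J z = (\<Sum>e\<in>E. \<bar>J e\<bar>) + lam * lp_norm V p z"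

lemma flow_cost_cong:
  assumes "\<And>e. e \<in> E \<Longrightarrow> J e = J' e" "\<And>v. v \<in> V \<Longrightarrow> z v = z' v"
  shows "flow_cost V E lam p J z = flow_cost V E lam p J' z'"
  using assms by (simp add: flow_cost_def cong: sum.cong lp_norm_cong)

lemma flow_cost_nonneg: "0 \<le> lam \<Longrightarrow> 0 \<le> flow_cost V E lam p J z"
  by (simp add: flow_cost_def lp_norm_nonneg sum_nonneg)

text \<open>The constraint determines \<open>z\<close> on \<open>V\<close> from \<open>J\<close>, so
  a continuous function of \<open>J\<close> alone is minimised. The minimiser is extensional, but it
  beats all competitors, extensional or not.\<close>

lemma unbalanced_cost_optimal_exists:
  fixes V :: "'v set"
  assumes "finite E" "0 \<le> lam" "0 < p"
  shows "\<exists>J z. J \<in> vectors E \<and> z \<in> vectors V \<and> residual_flow V E x y J z \<and>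
    (\<forall>J' z'. residual_flow V E x y J' z' \<longrightarrow> flow_cost V E lam p J z \<le> flow_cost V E lam p J' z')"
proof -
  define res where "res J = restrict (\<lambda>v. (\<Sum>e\<in>E. incidence e v * J e) - y v + x v) V" for J
  define cost where "cost J = flow_cost V E lam p J (res J)" for J
  \<comment> \<open>\<open>B\<close> is the cost of sending no flow. Freezing the coordinates
    outside \<open>E\<close> at \<open>undefined\<close> makes the box compact and places it inside
    \<open>vectors E\<close>.\<close>
  define B where "B = cost (\<lambda>_. 0)"
  define box where "box = PiE UNIV (\<lambda>e. if e \<in> E then {- B..B} else {undefined})"
  have flow_res: "residual_flow V E x y J (res J)" for J
    by (simp add: residual_flow_def res_def)
  have cost_restrict: "cost (restrict J E) = cost J" for J
    unfolding cost_def by (intro flow_cost_cong) (simp_all add: res_def cong: sum.cong)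
  have B: "0 \<le> B"
    using assms by (simp add: B_def cost_def flow_cost_nonneg)
  have zero: "restrict (\<lambda>_. 0) E \<in> box"
    using B by (auto simp: box_def)
  have "continuous_on box cost"
  proof -
    have coord: "continuous_on box (\<lambda>J. J e)" for e :: "'v \<times> 'v"
      by (rule continuous_on_subset[OF continuous_on_product_coordinates]) simp
    have "continuous_on box (\<lambda>J. res J v)" if "v \<in> V" for v
      using that by (simp add: res_def) (intro continuous_intros coord)
    then have "continuous_on box (\<lambda>J. lp_norm V p (res J))"
      using assms(3) by (rule continuous_on_lp_norm[rotated])
    then show ?thesis
      unfolding cost_def flow_cost_def by (intro continuous_intros coord)
  qed
  moreover have "compact box"
    unfolding box_def by (intro compact_PiE_UNIV) auto
  ultimately obtain J where J: "J \<in> box" "\<And>J'. J' \<in> box \<Longrightarrow> cost J \<le> cost J'"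
    using continuous_attains_inf[of box cost] zero by blast
  \<comment> \<open>A flow leaving the box carries more than \<open>B\<close> on a single edge, so
    it already costs more than the zero flow, which lies in the box.\<close>
  have min: "cost J \<le> cost J'" for J'
  proof (cases "restrict J' E \<in> box")
    case True
    then show ?thesis
      using J(2) cost_restrict by metis
  next
    case False
    then obtain e where e: "e \<in> E" "B < \<bar>J' e\<bar>"
      by (auto simp: box_def PiE_iff split: if_splits)
    have "cost J \<le> B"
      using J(2)[OF zero] by (simp add: cost_restrict B_def)
    also have "B \<le> \<bar>J' e\<bar>"
      using e by simp
    also have "\<dots> \<le> (\<Sum>e\<in>E. \<bar>J' e\<bar>)"
      using e assms by (intro member_le_sum) auto
    also have "\<dots> \<le> cost J'"
      using assms by (simp add: cost_def flow_cost_def lp_norm_nonneg)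
    finally show ?thesis .
  qed
  have "flow_cost V E lam p J (res J) \<le> flow_cost V E lam p J' z'"
    if "residual_flow V E x y J' z'" for J' z'
  proof -
    have "cost J' = flow_cost V E lam p J' z'"
      unfolding cost_def
      using that by (intro flow_cost_cong) (auto simp: residual_flow_def res_def)
    then show ?thesis
      using min[of J'] by (simp add: cost_def)
  qed
  moreover have "J \<in> vectors E"
    using J(1) by (auto simp: box_def vectors_def PiE_iff extensional_def split: if_splits)
  moreover have "res J \<in> vectors V"
    by (simp add: res_def vectors_def)
  ultimately show ?thesis
    using flow_res by blast
qed

text \<open>Attainment of the minimum gives the \<open>LEAST\<close> in
  \<open>unbalanced_cost\<close> its intended value; later arguments use only an optimal pair and
  the upper bound from any admissible pair.\<close>

lemma unbalanced_cost_optimal: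
  assumes "finite E" "0 \<le> lam" "0 < p"
  obtains J z where "residual_flow V E x y J z" "unbalanced_cost V E lam p x y = flow_cost V E lam p J z"
    "\<And>J' z'. residual_flow V E x y J' z' \<Longrightarrow> unbalanced_cost V E lam p x y \<le> flow_cost V E lam p J' z'"
proof -
  obtain J z where J: "J \<in> vectors E" "z \<in> vectors V" "residual_flow V E x y J z"
    and min: "\<And>J' z'. residual_flow V E x y J' z' \<Longrightarrow> flow_cost V E lam p J z \<le> flow_cost V E lam p J' z'"
    using unbalanced_cost_optimal_exists[OF assms] by metis
  have "unbalanced_cost V E lam p x y = flow_cost V E lam p J z"
    unfolding unbalanced_cost_def residual_flow_def[symmetric] flow_cost_def[symmetric]
    by (rule Least_equality) (use J min in blast)+
  with J(3) min that show thesis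
    by metis
qed

text \<open>Negating a flow and its residual exchanges the endpoints, and adding two flows composes
  them, with Minkowski's inequality bounding the residual term. Zero cost forces \<open>J\<close>
  and \<open>z\<close> to vanish, hence \<open>x\<close> and \<open>y\<close> agree on
  \<open>V\<close>; being extensional, they are equal.\<close>

lemma Metric_space_unbalanced_cost:
  assumes "finite V" "finite E" "0 < lam" "1 \<le> p"
  shows "Metric_space (vectors V) (unbalanced_cost V E lam p)"
proof -
  let ?C = "unbalanced_cost V E lam p" and ?c = "flow_cost V E lam p"
  have "0 \<le> lam" "0 < p"
    using assms by auto
  note opt = unbalanced_cost_optimal[OF assms(2) this, where V = V]
  have le: "?C x y \<le> ?c J z" if "residual_flow V E x y J z" for x y J z
    using opt[of x y] that by metis
  have nonneg: "0 \<le> ?C x y" for x y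
    using opt[of x y] flow_cost_nonneg[OF \<open>0 \<le> lam\<close>] by metis
  have sym_le: "?C x y \<le> ?C y x" for x y
  proof -
    obtain J z where J: "residual_flow V E y x J z" "?C y x = ?c J z"
      using opt[of y x] by metis
    have "residual_flow V E x y (\<lambda>e. - J e) (\<lambda>v. - z v)"
      using J(1) by (simp add: residual_flow_def sum_negf)
    moreover have "?c (\<lambda>e. - J e) (\<lambda>v. - z v) = ?c J z"
      by (simp add: flow_cost_def lp_norm_minus)
    ultimately show ?thesis
      using le J(2) by metis
  qed
  have triangle: "?C x w \<le> ?C x y + ?C y w" for x y w
  proof -
    obtain J z where J: "residual_flow V E x y J z" "?C x y = ?c J z"
      using opt[of x y] by metis
    obtain J' z' where J': "residual_flow V E y w J' z'" "?C y w = ?c J' z'"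
      using opt[of y w] by metis
    have "residual_flow V E x w (\<lambda>e. J e + J' e) (\<lambda>v. z v + z' v)"
      using J(1) J'(1) by (simp add: residual_flow_def sum.distrib distrib_left)
    then have "?C x w \<le> ?c (\<lambda>e. J e + J' e) (\<lambda>v. z v + z' v)"
      by (rule le)
    also have "\<dots> \<le> (\<Sum>e\<in>E. \<bar>J e\<bar> + \<bar>J' e\<bar>) + lam * (lp_norm V p z + lp_norm V p z')"
      unfolding flow_cost_def using assms
      by (intro add_mono sum_mono mult_left_mono lp_norm_triangle abs_triangle_ineq) auto
    also have "\<dots> = ?c J z + ?c J' z'"
      by (simp add: flow_cost_def sum.distrib distrib_left)
    finally show ?thesis
      using J J' by simp
  qed
  have zero: "?C x y = 0 \<longleftrightarrow> x = y" if "x \<in> vectors V" "y \<in> vectors V" for x y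
  proof
    assume "?C x y = 0"
    then obtain J z where J: "residual_flow V E x y J z" "?c J z = 0"
      using opt[of x y] by metis
    have "0 \<le> (\<Sum>e\<in>E. \<bar>J e\<bar>)" "0 \<le> lam * lp_norm V p z"
      using assms by (auto simp: lp_norm_nonneg intro: sum_nonneg)
    then have "(\<Sum>e\<in>E. \<bar>J e\<bar>) = 0" "lp_norm V p z = 0"
      using J(2) assms by (auto simp: flow_cost_def add_nonneg_eq_0_iff)
    then have "\<forall>e\<in>E. J e = 0" "\<forall>v\<in>V. z v = 0"
      using assms by (auto simp: lp_norm_eq_0_iff sum_nonneg_eq_0_iff)
    then have "x v = y v" if "v \<in> V" for v
      using J(1) that by (simp add: residual_flow_def)
    then show "x = y"
      using that unfolding vectors_def by (blast intro: PiE_ext)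
  next
    assume "x = y"
    then have "residual_flow V E x y (\<lambda>_. 0) (\<lambda>_. 0)"
      by (simp add: residual_flow_def)
    from le[OF this] have "?C x y \<le> 0"
      using lp_norm_eq_0_iff[OF assms(1), of p "\<lambda>_. 0"] by (simp add: flow_cost_def)
    with nonneg[of x y] show "?C x y = 0"
      by simp
  qed
  show ?thesis
    using nonneg sym_le triangle zero by unfold_locales (auto intro: antisym)
qed

section \<open>Doubly stochastic couplings\<close>

text \<open>Membership sees only the \<open>k\<close> by \<open>k\<close> block, so any matrix can
  be moved into the compact set of those vanishing outside it.\<close>

lemma doubly_stochastic_truncate:
  "(\<lambda>i j. if i < k \<and> j < k then S i j else 0) \<in> doubly_stochastic k \<longleftrightarrow> S \<in> doubly_stochastic k"
  by (simp add: doubly_stochastic_def cong: sum.cong_simp)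

lemma doubly_stochastic_identity:
  "(\<lambda>i j. if i = j then 1 else 0) \<in> doubly_stochastic k"
  by (auto simp: doubly_stochastic_def)

lemma doubly_stochastic_transpose:
  "S \<in> doubly_stochastic k \<Longrightarrow> (\<lambda>i j. S j i) \<in> doubly_stochastic k"
  by (simp add: doubly_stochastic_def)

text \<open>The product glues a coupling of \<open>xs\<close> with \<open>ys\<close> to one of
  \<open>ys\<close> with \<open>zs\<close>. After swapping the sums, the inner sum runs over a row
  of \<open>T\<close> or a column of \<open>S\<close> and equals 1.\<close>

lemma doubly_stochastic_mult:
  assumes "S \<in> doubly_stochastic k" "T \<in> doubly_stochastic k"
  shows "(\<lambda>i l. \<Sum>j<k. S i j * T j l) \<in> doubly_stochastic k"
proof -
  have "(\<Sum>l<k. \<Sum>j<k. S i j * T j l) = 1" if "i < k" for i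
    using assms that by (subst sum.swap) (simp add: doubly_stochastic_def flip: sum_distrib_left)
  moreover have "(\<Sum>i<k. \<Sum>j<k. S i j * T j l) = 1" if "l < k" for l
    using assms that by (subst sum.swap) (simp add: doubly_stochastic_def flip: sum_distrib_right)
  ultimately show ?thesis
    using assms by (auto simp: doubly_stochastic_def intro!: sum_nonneg)
qed

lemma doubly_stochastic_le_1:
  assumes "S \<in> doubly_stochastic k" "i < k" "j < k"
  shows "S i j \<le> 1"
proof -
  have "S i j \<le> (\<Sum>j<k. S i j)"
    using assms by (intro member_le_sum) (auto simp: doubly_stochastic_def)
  then show ?thesis
    using assms by (simp add: doubly_stochastic_def)
qed

(* Entries outside the k x k block are unconstrained, so doubly_stochastic k itself is not compact. *)
lemma compact_doubly_stochastic:
  "compact {S \<in> doubly_stochastic k. \<forall>i j. \<not> (i < k \<and> j < k) \<longrightarrow> S i j = 0}" (is "compact ?D")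
proof -
  \<comment> \<open>Nonnegativity and vanishing outside the block are built into the box, the bound
    1 follows from the row sums, and the row and column sums impose closed conditions.\<close>
  define box :: "(nat \<Rightarrow> nat \<Rightarrow> real) set" where
    "box = PiE UNIV (\<lambda>i. PiE UNIV (\<lambda>j. if i < k \<and> j < k then {0..1} else {0}))"
  have "compact box"
    unfolding box_def by (intro compact_PiE_UNIV) auto
  moreover have coord: "continuous_on UNIV (\<lambda>S :: nat \<Rightarrow> nat \<Rightarrow> real. S i j)" for i j
    by (intro continuous_on_product_then_coordinatewise[of _ "\<lambda>S. S i"]
        continuous_on_product_coordinates)
  have "closed (\<Inter>i<k. {S :: nat \<Rightarrow> nat \<Rightarrow> real. (\<Sum>j<k. S i j) = 1 \<and> (\<Sum>j<k. S j i) = 1})"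
    by (intro closed_INT ballI closed_Collect_conj closed_Collect_eq continuous_intros coord)
  ultimately have
    "compact (box \<inter> (\<Inter>i<k. {S. (\<Sum>j<k. S i j) = 1 \<and> (\<Sum>j<k. S j i) = 1}))"
    by (rule compact_Int_closed)
  also have "\<dots> = ?D"
    using doubly_stochastic_le_1[of _ k]
    by (fastforce simp: box_def PiE_iff doubly_stochastic_def split: if_splits)
  finally show ?thesis .
qed

text \<open>A continuous objective attains its minimum on the compact set \<open>D\<close>.
  Truncation leaves the objective unchanged, so this minimum is also the one over all of
  \<open>doubly_stochastic k\<close>.\<close>

lemma doubly_stochastic_minimizer_exists:
  fixes c :: "nat \<Rightarrow> nat \<Rightarrow> real"
  shows "\<exists>S\<in>doubly_stochastic k. \<forall>T\<in>doubly_stochastic k.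
    (\<Sum>i<k. \<Sum>j<k. S i j * c i j) \<le> (\<Sum>i<k. \<Sum>j<k. T i j * c i j)"
proof -
  define D where "D = {S \<in> doubly_stochastic k. \<forall>i j. \<not> (i < k \<and> j < k) \<longrightarrow> S i j = 0}"
  define f where "f S = (\<Sum>i<k. \<Sum>j<k. S i j * c i j)" for S :: "nat \<Rightarrow> nat \<Rightarrow> real"
  define trunc where "trunc S = (\<lambda>i j. if i < k \<and> j < k then S i j else 0)"
    for S :: "nat \<Rightarrow> nat \<Rightarrow> real"
  have trunc: "trunc S \<in> D" if "S \<in> doubly_stochastic k" for S
    using that doubly_stochastic_truncate[of k S] by (simp add: D_def trunc_def)
  have f_trunc: "f (trunc S) = f S" for S
    by (simp add: f_def trunc_def cong: sum.cong_simp)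
  have "continuous_on D (\<lambda>S. S i j)" for i j
    by (intro continuous_on_product_then_coordinatewise[of _ "\<lambda>S. S i"]
        continuous_on_subset[OF continuous_on_product_coordinates]) simp
  then have "continuous_on D f"
    unfolding f_def by (intro continuous_intros)
  moreover have "compact D"
    unfolding D_def by (rule compact_doubly_stochastic)
  moreover have "D \<noteq> {}"
    using trunc[OF doubly_stochastic_identity] by blast
  ultimately obtain S where "S \<in> D" "\<forall>T\<in>D. f S \<le> f T"
    using continuous_attains_inf by blast
  then have "S \<in> doubly_stochastic k" "\<forall>T\<in>doubly_stochastic k. f S \<le> f T"
    using trunc f_trunc by (auto simp: D_def) (metis)
  then show ?thesis
    unfolding f_def by blast
qed

lemma lifted_dist_list_least:
  fixes V E lam p k xs ys
  defines "f \<equiv> \<lambda>S. \<Sum>i<k. \<Sum>j<k. S i j * unbalanced_cost V E lam p (xs ! i) (ys ! j)"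
  shows lifted_dist_list_attained:
      "\<exists>S. S \<in> doubly_stochastic k \<and> lifted_dist_list V E lam p k xs ys = f S"
    and lifted_dist_list_le:
      "T \<in> doubly_stochastic k \<Longrightarrow> lifted_dist_list V E lam p k xs ys \<le> f T"
proof -
  obtain S where S: "S \<in> doubly_stochastic k" and min: "\<forall>T\<in>doubly_stochastic k. f S \<le> f T"
    unfolding f_def
    using doubly_stochastic_minimizer_exists
      [of k "\<lambda>i j. unbalanced_cost V E lam p (xs ! i) (ys ! j)"] by blast
  have eq: "lifted_dist_list V E lam p k xs ys = f S"
    unfolding lifted_dist_list_def
    by (rule Least_equality) (use S min in \<open>auto simp: f_def\<close>)
  show "\<exists>S. S \<in> doubly_stochastic k \<and> lifted_dist_list V E lam p k xs ys = f S"
    using S eq by (intro exI conjI)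
  show "lifted_dist_list V E lam p k xs ys \<le> f T" if "T \<in> doubly_stochastic k"
    using min that by (simp add: eq)
qed

text \<open>Double counting: the multiplicity of \<open>a\<close> in \<open>xs\<close> is the mass
  of \<open>S\<close> in the rows labelled \<open>a\<close>, and its multiplicity in
  \<open>ys\<close> is the mass in the columns labelled \<open>a\<close>.\<close>

lemma mset_eq_of_doubly_stochastic_support:
  fixes xs ys :: "'a list"
  assumes "S \<in> doubly_stochastic k" "length xs = k" "length ys = k"
    and support: "\<And>i j. i < k \<Longrightarrow> j < k \<Longrightarrow> S i j \<noteq> 0 \<Longrightarrow> xs ! i = ys ! j"
  shows "mset xs = mset ys"
proof (rule multiset_eqI)
  fix a :: 'a
  have count: "real (count (mset zs) a) = (\<Sum>i<k. of_bool (zs ! i = a))"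
    if "length zs = k" for zs :: "'a list"
    using that by (simp add: count_mset count_list_eq_length_filter length_filter_conv_card
        sum.If_cases of_bool_def Int_def eq_commute[of a])
  have "real (count (mset xs) a) = (\<Sum>i<k. \<Sum>j<k. S i j * of_bool (xs ! i = a))"
    using assms(1) by (simp add: count[OF assms(2)] doubly_stochastic_def flip: sum_distrib_right)
  \<comment> \<open>Off the support both terms are 0; on it the two labels coincide.\<close>
  also have "\<dots> = (\<Sum>i<k. \<Sum>j<k. S i j * of_bool (ys ! j = a))"
    by (intro sum.cong refl) (use support in force)
  also have "\<dots> = (\<Sum>j<k. \<Sum>i<k. S i j * of_bool (ys ! j = a))"
    by (rule sum.swap)
  also have "\<dots> = real (count (mset ys) a)"
    using assms(1) by (simp add: count[OF assms(3)] doubly_stochastic_def flip: sum_distrib_right)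
  finally show "count (mset xs) a = count (mset ys) a"
    by simp
qed

section \<open>The lifted distance\<close>

theorem proposition6p3:
  fixes V :: "'v set" and E :: "('v \<times> 'v) set" and k :: nat and lam p :: real
  assumes "oriented_graph V E"
    and "1 \<le> k" and "0 < lam" and "1 \<le> p"
  shows "Metric_space (unordered_tuples k (mass_vectors V)) (lifted_dist V E lam p k)"
proof -
  interpret oriented_graph V E
    by fact
  have "finite E"
    using finite_verts edges_subset finite_subset by blast
  let ?C = "unbalanced_cost V E lam p" and ?A = "lifted_dist_list V E lam p k"
  interpret C: Metric_space "vectors V" ?C
    using finite_verts \<open>finite E\<close> assms by (intro Metric_space_unbalanced_cost)
  have le: "?A xs ys \<le> (\<Sum>i<k. \<Sum>j<k. S i j * ?C (xs ! i) (ys ! j))"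
    if "S \<in> doubly_stochastic k" for S xs ys
    by (rule lifted_dist_list_le[OF that])
  \<comment> \<open>The axioms are proved for lists first. \<open>Metric_space\<close> gives
    nonnegativity and symmetry for all arguments, but the triangle inequality and the zero criterion
    only on the carrier; the facts below have matching premises.\<close>
  have nonneg: "0 \<le> ?A xs ys" for xs ys
  proof -
    obtain S where "S \<in> doubly_stochastic k"
      "?A xs ys = (\<Sum>i<k. \<Sum>j<k. S i j * ?C (xs ! i) (ys ! j))"
      using lifted_dist_list_attained by blast
    then show ?thesis
      by (auto simp: doubly_stochastic_def intro!: sum_nonneg)
  qed
  have sym_le: "?A xs ys \<le> ?A ys xs" for xs ys
  proof -
    obtain S where S: "S \<in> doubly_stochastic k"
      "?A ys xs = (\<Sum>i<k. \<Sum>j<k. S i j * ?C (ys ! i) (xs ! j))"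
      using lifted_dist_list_attained by blast
    have "?A xs ys \<le> (\<Sum>i<k. \<Sum>j<k. S j i * ?C (xs ! i) (ys ! j))"
      using le[OF doubly_stochastic_transpose[OF S(1)]] .
    also have "\<dots> = ?A ys xs"
      unfolding S(2) by (subst sum.swap) (simp add: C.commute)
    finally show ?thesis .
  qed
  have triangle: "?A xs zs \<le> ?A xs ys + ?A ys zs"
    if xs: "\<And>i. i < k \<Longrightarrow> xs ! i \<in> vectors V" and ys: "\<And>i. i < k \<Longrightarrow> ys ! i \<in> vectors V"
      and zs: "\<And>i. i < k \<Longrightarrow> zs ! i \<in> vectors V" for xs ys zs
  proof -
    obtain S where S: "S \<in> doubly_stochastic k"
      "?A xs ys = (\<Sum>i<k. \<Sum>j<k. S i j * ?C (xs ! i) (ys ! j))"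
      using lifted_dist_list_attained by blast
    obtain T where T: "T \<in> doubly_stochastic k"
      "?A ys zs = (\<Sum>i<k. \<Sum>j<k. T i j * ?C (ys ! i) (zs ! j))"
      using lifted_dist_list_attained by blast
    have "?A xs zs \<le> (\<Sum>i<k. \<Sum>l<k. (\<Sum>j<k. S i j * T j l) * ?C (xs ! i) (zs ! l))"
      using le[OF doubly_stochastic_mult[OF S(1) T(1)]] .
    also have "\<dots> \<le> (\<Sum>i<k. \<Sum>l<k. \<Sum>j<k. S i j * T j l * (?C (xs ! i) (ys ! j) + ?C (ys ! j) (zs ! l)))"
      unfolding sum_distrib_right using S(1) T(1)
      by (intro sum_mono mult_left_mono C.triangle xs ys zs) (auto simp: doubly_stochastic_def)
    \<comment> \<open>The costs are separated so that summing over \<open>l\<close> removes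
      \<open>T\<close> by its row sums in the first part, and summing over \<open>i\<close> removes
      \<open>S\<close> by its column sums in the second.\<close>
    also have "\<dots> = (\<Sum>i<k. \<Sum>j<k. \<Sum>l<k. S i j * ?C (xs ! i) (ys ! j) * T j l)
        + (\<Sum>i<k. \<Sum>j<k. \<Sum>l<k. T j l * ?C (ys ! j) (zs ! l) * S i j)"
      by (subst sum.swap[of _ "{..<k}" "{..<k}"]) (simp add: algebra_simps sum.distrib)
    also have "(\<Sum>i<k. \<Sum>j<k. \<Sum>l<k. S i j * ?C (xs ! i) (ys ! j) * T j l) = ?A xs ys"
      unfolding S(2) using T(1)
      by (intro sum.cong refl) (simp add: doubly_stochastic_def flip: sum_distrib_left)
    also have "(\<Sum>i<k. \<Sum>j<k. \<Sum>l<k. T j l * ?C (ys ! j) (zs ! l) * S i j)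
        = (\<Sum>j<k. \<Sum>l<k. \<Sum>i<k. T j l * ?C (ys ! j) (zs ! l) * S i j)"
      by (rule trans[OF sum.swap], rule sum.cong[OF refl], rule sum.swap)
    also have "\<dots> = ?A ys zs"
      unfolding T(2) using S(1)
      by (intro sum.cong refl) (simp add: doubly_stochastic_def flip: sum_distrib_left)
    finally show ?thesis .
  qed
  have zero_imp: "mset xs = mset ys"
    if "?A xs ys = 0" and len: "length xs = k" "length ys = k"
      and xs: "\<And>i. i < k \<Longrightarrow> xs ! i \<in> vectors V" and ys: "\<And>i. i < k \<Longrightarrow> ys ! i \<in> vectors V"
    for xs ys
  proof -
    obtain S where S: "S \<in> doubly_stochastic k"
      "?A xs ys = (\<Sum>i<k. \<Sum>j<k. S i j * ?C (xs ! i) (ys ! j))"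
      using lifted_dist_list_attained by blast
    have pos: "0 \<le> S i j * ?C (xs ! i) (ys ! j)" if "i < k" "j < k" for i j
      using S(1) that by (simp add: doubly_stochastic_def)
    \<comment> \<open>All terms are nonnegative, so each row total vanishes, and then each
      entry.\<close>
    have "S i j * ?C (xs ! i) (ys ! j) = 0" if "i < k" "j < k" for i j
    proof -
      have "(\<Sum>j<k. S i j * ?C (xs ! i) (ys ! j)) = 0"
        using \<open>?A xs ys = 0\<close> \<open>i < k\<close> pos unfolding S(2)
        by (subst (asm) sum_nonneg_eq_0_iff) (auto intro!: sum_nonneg)
      then show ?thesis
        using that pos by (subst (asm) sum_nonneg_eq_0_iff) auto
    qed
    then have "xs ! i = ys ! j" if "i < k" "j < k" "S i j \<noteq> 0" for i j
      using that C.zero[OF xs ys] by fastforce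
    then show ?thesis
      using mset_eq_of_doubly_stochastic_support[OF S(1) len] by blast
  qed
  have refl_0: "?A xs xs = 0" if "\<And>i. i < k \<Longrightarrow> xs ! i \<in> vectors V" for xs
  proof -
    have "?A xs xs \<le> (\<Sum>i<k. \<Sum>j<k. (if i = j then 1 else 0) * ?C (xs ! i) (xs ! j))"
      by (rule le[OF doubly_stochastic_identity])
    also have "\<dots> = 0"
      using that by (intro sum.neutral ballI) auto
    finally show ?thesis
      using nonneg[of xs xs] by simp
  qed
  have list: "\<exists>xs. mset xs = X \<and> length xs = k \<and> (\<forall>i<k. xs ! i \<in> vectors V)"
    if "X \<in> unordered_tuples k (mass_vectors V)" for X
  proof -
    obtain xs where "mset xs = X"
      using ex_mset by blast
    then show ?thesis
      using that by (intro exI[of _ xs])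
        (auto simp: unordered_tuples_def mass_vectors_def dest!: nth_mem)
  qed
  show ?thesis
  proof
    \<comment> \<open>Nonnegativity and symmetry hold for every pair of lists, so the orderings
      chosen by \<open>SOME\<close> may stay unspecified. The other two axioms pass to concrete
      orderings by \<open>lifted_dist_mset\<close>.\<close>
    show "0 \<le> lifted_dist V E lam p k X Y" for X Y
      by (simp add: lifted_dist_def nonneg)
    show "lifted_dist V E lam p k X Y = lifted_dist V E lam p k Y X" for X Y
      unfolding lifted_dist_def by (intro antisym sym_le)
    show "lifted_dist V E lam p k X Y = 0 \<longleftrightarrow> X = Y"
      if X: "X \<in> unordered_tuples k (mass_vectors V)" and Y: "Y \<in> unordered_tuples k (mass_vectors V)"
      for X Y
    proof -
      obtain xs ys where "mset xs = X" "length xs = k" "\<forall>i<k. xs ! i \<in> vectors V"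
        "mset ys = Y" "length ys = k" "\<forall>i<k. ys ! i \<in> vectors V"
        using list[OF X] list[OF Y] by blast
      then show ?thesis
        using zero_imp[of xs ys] refl_0[of xs] lifted_dist_mset[of xs k ys V E lam p]
          lifted_dist_mset[of xs k xs V E lam p] by auto
    qed
    show "lifted_dist V E lam p k X Z \<le> lifted_dist V E lam p k X Y + lifted_dist V E lam p k Y Z"
      if X: "X \<in> unordered_tuples k (mass_vectors V)" and Y: "Y \<in> unordered_tuples k (mass_vectors V)"
        and Z: "Z \<in> unordered_tuples k (mass_vectors V)" for X Y Z
    proof -
      obtain xs ys zs where "mset xs = X" "length xs = k" "\<forall>i<k. xs ! i \<in> vectors V"
        "mset ys = Y" "length ys = k" "\<forall>i<k. ys ! i \<in> vectors V"
        "mset zs = Z" "length zs = k" "\<forall>i<k. zs ! i \<in> vectors V"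
        using list[OF X] list[OF Y] list[OF Z] by blast
      then show ?thesis
        using triangle[of xs ys zs] lifted_dist_mset[of _ k _ V E lam p] by metis
    qed
  qed
qed

end
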